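(* Let $X$ be a quandle, $A$ an abelian group (written multiplicatively) and $\theta:X\times X\to A$ a quandle $2$-cocycle. Let $f_\theta:X\times X\to\mathbb{Z}[A]$ be the composite of $\theta$ with the natural inclusion $A\hookrightarrow\mathbb{Z}[A]$ into the group ring, and let $0:X\times X\to\mathbb{Z}[A]$ be the constant map to $0$. Then the pair $(f_\theta,0)$ is an Alexander pair.
   Context: A quandle is a set $X$ with a binary operation $*$ such that $x*x=x$ for all $x$; for every $y$ the map $x\mapsto x*y$ is a bijection of $X$; and $(x*y)*z=(x*z)*(y*z)$ for all $x,y,z$. A map $\theta:X\times X\to A$ is a quandle $2$-cocycle if $\theta(x,x)=e$ (the identity of $A$) for all $x\in X$ and $\theta(x*y,z)\theta(x,y)=\theta(x*z,y*z)\theta(x,z)$ for all $x,y,z\in X$. Let $R$ be a ring with unity $1$. A pair $(f_1,f_2)$ of maps $f_1,f_2:X\times X\to R$ is an Alexander pair if for all $x,y,z\in X$: $f_1(x,x)+f_2(x,x)=1$; $f_1(x,y)$ is a unit of $R$; $f_1(x*y,z)f_1(x,y)=f_1(x*z,y*z)f_1(x,z)$; $f_1(x*y,z)f_2(x,y)=f_2(x*z,y*z)f_1(y,z)$; and $f_2(x*y,z)=f_1(x*z,y*z)f_2(x,z)+f_2(x*z,y*z)f_2(y,z)$. *)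

theory Defs
  imports "HOL-Algebra.Ring" "HOL-Library.Poly_Mapping"
begin

locale quandle =
  fixes X :: "'x set" and qop :: "'x \<Rightarrow> 'x \<Rightarrow> 'x" (infixl "\<triangleleft>" 70)
  assumes closed: "\<lbrakk>x \<in> X; y \<in> X\<rbrakk> \<Longrightarrow> x \<triangleleft> y \<in> X"
    and idem: "x \<in> X \<Longrightarrow> x \<triangleleft> x = x"
    and right_bij: "y \<in> X \<Longrightarrow> bij_betw (\<lambda>x. x \<triangleleft> y) X X"
    and right_distrib: "\<lbrakk>x \<in> X; y \<in> X; z \<in> X\<rbrakk> \<Longrightarrow> (x \<triangleleft> y) \<triangleleft> z = (x \<triangleleft> z) \<triangleleft> (y \<triangleleft> z)"

locale quandle_2_cocycle = quandle X qop + group A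
  for X :: "'x set" and qop :: "'x \<Rightarrow> 'x \<Rightarrow> 'x" (infixl "\<triangleleft>" 70)
    and A :: "('a, 'm) monoid_scheme" (structure) +
  fixes \<theta> :: "'x \<times> 'x \<Rightarrow> 'a"
  assumes cocycle_closed: "\<theta> \<in> X \<times> X \<rightarrow> carrier A"
    and cocycle_diag: "x \<in> X \<Longrightarrow> \<theta> (x, x) = \<one>"
    and cocycle: "\<lbrakk>x \<in> X; y \<in> X; z \<in> X\<rbrakk> \<Longrightarrow>
      \<theta> (x \<triangleleft> y, z) \<otimes> \<theta> (x, y) = \<theta> (x \<triangleleft> z, y \<triangleleft> z) \<otimes> \<theta> (x, z)"

locale alexander_pair = quandle X qop + ring R
  for X :: "'x set" and qop :: "'x \<Rightarrow> 'x \<Rightarrow> 'x" (infixl "\<triangleleft>" 70)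
    and R :: "('r, 'm) ring_scheme" (structure) +
  fixes f1 f2 :: "'x \<times> 'x \<Rightarrow> 'r"
  assumes f1_closed: "f1 \<in> X \<times> X \<rightarrow> carrier R"
    and f2_closed: "f2 \<in> X \<times> X \<rightarrow> carrier R"
    and diag: "x \<in> X \<Longrightarrow> f1 (x, x) \<oplus> f2 (x, x) = \<one>"
    and f1_unit: "\<lbrakk>x \<in> X; y \<in> X\<rbrakk> \<Longrightarrow> f1 (x, y) \<in> Units R"
    and f1_f1: "\<lbrakk>x \<in> X; y \<in> X; z \<in> X\<rbrakk> \<Longrightarrow>
      f1 (x \<triangleleft> y, z) \<otimes> f1 (x, y) = f1 (x \<triangleleft> z, y \<triangleleft> z) \<otimes> f1 (x, z)"
    and f1_f2: "\<lbrakk>x \<in> X; y \<in> X; z \<in> X\<rbrakk> \<Longrightarrow>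
      f1 (x \<triangleleft> y, z) \<otimes> f2 (x, y) = f2 (x \<triangleleft> z, y \<triangleleft> z) \<otimes> f1 (y, z)"
    and f2_sum: "\<lbrakk>x \<in> X; y \<in> X; z \<in> X\<rbrakk> \<Longrightarrow>
      f2 (x \<triangleleft> y, z) =
        f1 (x \<triangleleft> z, y \<triangleleft> z) \<otimes> f2 (x, z) \<oplus> f2 (x \<triangleleft> z, y \<triangleleft> z) \<otimes> f2 (y, z)"

(* The integral group ring \<int>[A].  Its additive group is that of free_Abelian_group (carrier A),
   and its product is the biadditive extension of frag_of a * frag_of b = frag_of (a \<otimes> b);
   the natural inclusion of A into \<int>[A] is therefore frag_of. *)
definition group_ring :: "('a, 'm) monoid_scheme \<Rightarrow> ('a \<Rightarrow>\<^sub>0 int) ring"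
  where "group_ring A =
    \<lparr>carrier = {c. Poly_Mapping.keys c \<subseteq> carrier A},
     monoid.mult = (\<lambda>c d. frag_extend (\<lambda>a. frag_extend (\<lambda>b. frag_of (a \<otimes>\<^bsub>A\<^esub> b)) d) c),
     one = frag_of \<one>\<^bsub>A\<^esub>,
     zero = 0,
     add = (+)\<rparr>"

end

theory Submission
  imports Defs
begin

text \<open>
  Since the second map is zero, the two mixed conditions of an Alexander pair reduce to
  \<open>0 = 0\<close> in the ring \<open>\<int>[A]\<close>, and the condition on the diagonal becomes \<open>f\<^sub>\<theta> (x, x) = 1\<close>. The
  remaining conditions concern \<open>f\<^sub>\<theta>\<close> alone. The inclusion of \<open>A\<close> into \<open>\<int>[A]\<close> is multiplicative and
  preserves the identity (\<open>group_ring_mult_frag_of\<close>, \<open>group_ring_one\<close>), so it carries the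
  normalisation \<open>\<theta> (x, x) = e\<close> and the cocycle identity of \<open>\<theta>\<close> to the conditions on \<open>f\<^sub>\<theta>\<close>, and
  it sends every group element to a unit (\<open>frag_of_in_Units_group_ring\<close>).

  Most of the work lies in showing that \<open>\<int>[A]\<close> is a ring at all (\<open>ring_group_ring\<close>). The product
  is biadditive because it is built from additive extensions, and the basis elements generate
  the additive group. Thus the unit laws and associativity follow from the corresponding
  laws in \<open>A\<close> by additivity in each argument.
\<close>

lemma group_ring_carrier: "carrier (group_ring A) = {c. Poly_Mapping.keys c \<subseteq> carrier A}"
  and group_ring_one: "\<one>\<^bsub>group_ring A\<^esub> = frag_of \<one>\<^bsub>A\<^esub>"
  and group_ring_zero: "\<zero>\<^bsub>group_ring A\<^esub> = 0"
  and group_ring_add: "c \<oplus>\<^bsub>group_ring A\<^esub> d = c + d"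
  and group_ring_mult: "c \<otimes>\<^bsub>group_ring A\<^esub> d =
    frag_extend (\<lambda>a. frag_extend (\<lambda>b. frag_of (a \<otimes>\<^bsub>A\<^esub> b)) d) c"
  by (simp_all add: group_ring_def)

lemma frag_extend_fun_diff: "frag_extend (\<lambda>a. f a - g a) c = frag_extend f c - frag_extend g c"
  using subset_UNIV
  by (induction c rule: frag_induction) (simp_all add: frag_extend_diff)

lemma group_ring_mult_frag_of:
  "frag_of a \<otimes>\<^bsub>group_ring A\<^esub> frag_of b = frag_of (a \<otimes>\<^bsub>A\<^esub> b)"
  by (simp add: group_ring_mult)

lemma group_ring_mult_zero:
  "0 \<otimes>\<^bsub>group_ring A\<^esub> d = 0" "c \<otimes>\<^bsub>group_ring A\<^esub> 0 = 0"
  by (simp_all add: group_ring_mult frag_extend_eq_0)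

lemma group_ring_mult_diff_left:
  "(c - c') \<otimes>\<^bsub>group_ring A\<^esub> d = c \<otimes>\<^bsub>group_ring A\<^esub> d - c' \<otimes>\<^bsub>group_ring A\<^esub> d"
  by (simp add: group_ring_mult frag_extend_diff)

lemma group_ring_mult_diff_right:
  "c \<otimes>\<^bsub>group_ring A\<^esub> (d - d') = c \<otimes>\<^bsub>group_ring A\<^esub> d - c \<otimes>\<^bsub>group_ring A\<^esub> d'"
  by (simp add: group_ring_mult frag_extend_diff frag_extend_fun_diff)

lemma group_ring_mult_add_left:
  "(c + c') \<otimes>\<^bsub>group_ring A\<^esub> d = c \<otimes>\<^bsub>group_ring A\<^esub> d + c' \<otimes>\<^bsub>group_ring A\<^esub> d"
  by (simp add: group_ring_mult frag_extend_add)

lemma group_ring_mult_add_right: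
  "c \<otimes>\<^bsub>group_ring A\<^esub> (d + d') = c \<otimes>\<^bsub>group_ring A\<^esub> d + c \<otimes>\<^bsub>group_ring A\<^esub> d'"
  using group_ring_mult_diff_right[of A c "d + d'" d'] by (simp add: algebra_simps)

lemma frag_of_in_carrier_group_ring:
  "a \<in> carrier A \<Longrightarrow> frag_of a \<in> carrier (group_ring A)"
  by (simp add: group_ring_carrier)

context monoid
begin

lemma group_ring_mult_closed:
  assumes "c \<in> carrier (group_ring G)" "d \<in> carrier (group_ring G)"
  shows "c \<otimes>\<^bsub>group_ring G\<^esub> d \<in> carrier (group_ring G)"
  using assms unfolding group_ring_mult group_ring_carrier
  by (fastforce dest!: subsetD [OF keys_frag_extend])

lemma group_ring_mult_assoc:
  assumes "c \<in> carrier (group_ring G)" "d \<in> carrier (group_ring G)" "e \<in> carrier (group_ring G)"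
  shows "(c \<otimes>\<^bsub>group_ring G\<^esub> d) \<otimes>\<^bsub>group_ring G\<^esub> e = c \<otimes>\<^bsub>group_ring G\<^esub> (d \<otimes>\<^bsub>group_ring G\<^esub> e)"
proof -
  note biadditive = group_ring_mult_zero group_ring_mult_diff_left group_ring_mult_diff_right
  have keys: "Poly_Mapping.keys c \<subseteq> carrier G" "Poly_Mapping.keys d \<subseteq> carrier G"
    "Poly_Mapping.keys e \<subseteq> carrier G"
    using assms by (simp_all add: group_ring_carrier)
  \<comment> \<open>Both sides are additive in each argument, so inductions on \<open>e\<close>, \<open>d\<close> and \<open>c\<close> in turn
    reduce the identity to associativity in \<open>G\<close>.\<close>
  have basis: "(frag_of a \<otimes>\<^bsub>group_ring G\<^esub> frag_of b) \<otimes>\<^bsub>group_ring G\<^esub> e =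
      frag_of a \<otimes>\<^bsub>group_ring G\<^esub> (frag_of b \<otimes>\<^bsub>group_ring G\<^esub> e)"
    if "a \<in> carrier G" "b \<in> carrier G" for a b
    using keys(3)
    by (induction e rule: frag_induction)
      (simp_all add: that biadditive group_ring_mult_frag_of m_assoc)
  have left: "(frag_of a \<otimes>\<^bsub>group_ring G\<^esub> d) \<otimes>\<^bsub>group_ring G\<^esub> e =
      frag_of a \<otimes>\<^bsub>group_ring G\<^esub> (d \<otimes>\<^bsub>group_ring G\<^esub> e)"
    if "a \<in> carrier G" for a
    using keys(2)
    by (induction d rule: frag_induction) (simp_all add: that basis biadditive)
  show ?thesis
    using keys(1)
    by (induction c rule: frag_induction) (simp_all add: left biadditive)
qed

lemma group_ring_one_mult:
  assumes "c \<in> carrier (group_ring G)"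
  shows "\<one>\<^bsub>group_ring G\<^esub> \<otimes>\<^bsub>group_ring G\<^esub> c = c" "c \<otimes>\<^bsub>group_ring G\<^esub> \<one>\<^bsub>group_ring G\<^esub> = c"
proof -
  have keys: "Poly_Mapping.keys c \<subseteq> carrier G"
    using assms by (simp add: group_ring_carrier)
  then show "\<one>\<^bsub>group_ring G\<^esub> \<otimes>\<^bsub>group_ring G\<^esub> c = c"
    by (induction c rule: frag_induction)
      (simp_all add: group_ring_one group_ring_mult_zero group_ring_mult_frag_of
        group_ring_mult_diff_right)
  from keys show "c \<otimes>\<^bsub>group_ring G\<^esub> \<one>\<^bsub>group_ring G\<^esub> = c"
    by (induction c rule: frag_induction)
      (simp_all add: group_ring_one group_ring_mult_zero group_ring_mult_frag_of
        group_ring_mult_diff_left)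
qed

lemma ring_group_ring: "ring (group_ring G)"
proof (rule ringI)
  show "abelian_group (group_ring G)"
  proof (rule abelian_groupI)
    fix c assume "c \<in> carrier (group_ring G)"
    then show "\<exists>d \<in> carrier (group_ring G). d \<oplus>\<^bsub>group_ring G\<^esub> c = \<zero>\<^bsub>group_ring G\<^esub>"
      by (intro bexI [of _ "- c"])
        (simp_all add: group_ring_carrier group_ring_add group_ring_zero)
  qed (auto simp: group_ring_carrier group_ring_add group_ring_zero add_ac
      dest!: subsetD [OF keys_add])
  show "monoid (group_ring G)"
  proof (rule monoidI)
    show "\<one>\<^bsub>group_ring G\<^esub> \<in> carrier (group_ring G)"
      by (simp add: group_ring_one frag_of_in_carrier_group_ring)
  qed (simp_all add: group_ring_mult_closed group_ring_mult_assoc group_ring_one_mult)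
qed (simp_all add: group_ring_add group_ring_mult_add_left group_ring_mult_add_right)

end

lemma (in group) frag_of_in_Units_group_ring:
  assumes "a \<in> carrier G"
  shows "frag_of a \<in> Units (group_ring G)"
  unfolding Units_def using assms
  by (auto simp: group_ring_mult_frag_of group_ring_one frag_of_in_carrier_group_ring
      intro!: bexI [of _ "frag_of (inv a)"])

theorem lemma5p1:
  fixes X :: "'x set" and qop :: "'x \<Rightarrow> 'x \<Rightarrow> 'x"
    and A :: "('a, 'm) monoid_scheme" and \<theta> :: "'x \<times> 'x \<Rightarrow> 'a"
  assumes "quandle X qop"
    and "comm_group A"
    and "quandle_2_cocycle X qop A \<theta>"
  shows "alexander_pair X qop (group_ring A) (frag_of \<circ> \<theta>) (\<lambda>_. \<zero>\<^bsub>group_ring A\<^esub>)"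
proof -
  interpret C: quandle_2_cocycle X qop A \<theta> by fact
  interpret R: ring "group_ring A" by (rule C.ring_group_ring)
  have \<theta>_closed: "\<theta> (x, y) \<in> carrier A" if "x \<in> X" "y \<in> X" for x y
    using C.cocycle_closed that by blast
  have f_closed: "frag_of (\<theta> (x, y)) \<in> carrier (group_ring A)" if "x \<in> X" "y \<in> X" for x y
    using that by (intro frag_of_in_carrier_group_ring \<theta>_closed)
  show ?thesis
  proof unfold_locales
    show "frag_of \<circ> \<theta> \<in> X \<times> X \<rightarrow> carrier (group_ring A)"
      using f_closed by auto
  next
    fix x assume "x \<in> X"
    then show "(frag_of \<circ> \<theta>) (x, x) \<oplus>\<^bsub>group_ring A\<^esub> \<zero>\<^bsub>group_ring A\<^esub> = \<one>\<^bsub>group_ring A\<^esub>"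
      by (simp add: C.cocycle_diag group_ring_one group_ring_add group_ring_zero)
  next
    fix x y assume "x \<in> X" "y \<in> X"
    then show "(frag_of \<circ> \<theta>) (x, y) \<in> Units (group_ring A)"
      by (simp add: C.frag_of_in_Units_group_ring \<theta>_closed)
  next
    fix x y z assume "x \<in> X" "y \<in> X" "z \<in> X"
    then show "(frag_of \<circ> \<theta>) (qop x y, z) \<otimes>\<^bsub>group_ring A\<^esub> (frag_of \<circ> \<theta>) (x, y) =
        (frag_of \<circ> \<theta>) (qop x z, qop y z) \<otimes>\<^bsub>group_ring A\<^esub> (frag_of \<circ> \<theta>) (x, z)"
      by (simp add: group_ring_mult_frag_of C.cocycle)
  qed (simp_all add: f_closed C.closed)
qed

end
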